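(* Let $C$ be a nonempty closed convex subset of a real Hilbert space $H$ and $T$ a nonexpansive mapping of $C$ into itself such that $F(T)\ne\emptyset$. Assume that $\{\alpha_n\}_{n\ge0}$ and $\{\beta_n\}_{n\ge0}$ are sequences in $[0,1]$ such that $0<\beta\le\beta_n\le1$ for all $n$ (for some constant $\beta$) and $\alpha_n\to0$. Let $x_0\in C$ be arbitrary and define $\{x_n\}$ in $C$, for $n\ge0$, by $$v_n=(1-\alpha_n)x_n+\alpha_nTx_n,\qquad y_n=(1-\beta_n)x_n+\beta_nTv_n,$$ $$C_n=\{z\in C:\|z-y_n\|^2\le\|z-x_n\|^2+\beta_n(\|v_n\|^2-\|x_n\|^2+2\langle x_n-v_n,z\rangle)\},$$ $$Q_n=\{z\in C:\langle z-x_n,x_n-x_0\rangle\ge0\},$$ $$x_{n+1}=P_{C_n^*\cap Q_n}x_0,$$ where $C_n^*$ is a closed convex set with $F(T)\subset C_n^*\subset C_n$. Then $\{x_n\}$ converges strongly to $P_{F(T)}x_0$.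
   Context: $F(T)=\{x\in C:Tx=x\}$. $T$ is nonexpansive if $\|Tx-Ty\|\le\|x-y\|$ for all $x,y\in C$. For a nonempty closed convex set $D\subset H$, $P_D$ is the metric projection (nearest-point map) onto $D$. *)

theory Defs
  imports "HOL-Analysis.Analysis"
begin

(* A real Hilbert space is a type of sort {real_inner, complete_space}. *)

(* The domain C is a separate argument because T is total as a HOL function,
   while its values outside C are irrelevant. *)
definition fix_set :: "'a set \<Rightarrow> ('a \<Rightarrow> 'a) \<Rightarrow> 'a set"
  where "fix_set C T = {x \<in> C. T x = x}"

(* The library's closest_point is restricted to the sort heine_borel, that is, to
   finite dimension. The value below is meaningful when D is nonempty, closed and
   convex in a Hilbert space; see ex1_nearest_point. *)
definition metric_proj :: "'a::real_inner set \<Rightarrow> 'a \<Rightarrow> 'a"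
  where "metric_proj D u = (THE z. z \<in> D \<and> (\<forall>w\<in>D. norm (u - z) \<le> norm (u - w)))"

lemma nearest_points_close:
  fixes u :: "'a::real_inner"
  assumes "convex D" "a \<in> D" "b \<in> D"
    and low: "\<And>w. w \<in> D \<Longrightarrow> d \<le> norm (u - w)" and "0 \<le> d"
    and a: "norm (u - a) \<le> r" and b: "norm (u - b) \<le> r"
  shows "(norm (a - b))\<^sup>2 \<le> 4 * (r\<^sup>2 - d\<^sup>2)"
proof -
  define m where "m = (1/2) *\<^sub>R a + (1/2) *\<^sub>R b"
  have "m \<in> D"
    unfolding m_def using assms(1-3) by (intro convexD) auto
  then have m: "d\<^sup>2 \<le> (norm (u - m))\<^sup>2"
    using low[of m] \<open>0 \<le> d\<close> by (intro power_mono) auto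
  have "(norm (a - b))\<^sup>2 = 2 * (norm (u - a))\<^sup>2 + 2 * (norm (u - b))\<^sup>2 - 4 * (norm (u - m))\<^sup>2"
    unfolding m_def power2_norm_eq_inner
    by (simp add: inner_diff_left inner_diff_right inner_add_left inner_add_right
        inner_commute algebra_simps)
  moreover have "(norm (u - a))\<^sup>2 \<le> r\<^sup>2" "(norm (u - b))\<^sup>2 \<le> r\<^sup>2"
    using a b by (auto intro: power_mono)
  ultimately show ?thesis
    using m by simp
qed

lemma ex1_nearest_point:
  fixes u :: "'a::{real_inner,complete_space}"
  assumes "closed D" "convex D" "D \<noteq> {}"
  shows "\<exists>!z. z \<in> D \<and> (\<forall>w\<in>D. norm (u - z) \<le> norm (u - w))"
proof -
  define d where "d = infdist u D"
  have low: "d \<le> norm (u - w)" if "w \<in> D" for w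
    using infdist_le[OF that] by (simp add: d_def dist_norm)
  have d0: "0 \<le> d"
    by (simp add: d_def infdist_nonneg)
  define S where "S = (\<lambda>n::nat. D \<inter> cball u (d + 1 / real (Suc n)))"
  have ne: "S n \<noteq> {}" for n
  proof -
    have "Inf (dist u ` D) < d + 1 / real (Suc n)"
      using \<open>D \<noteq> {}\<close> by (simp add: d_def infdist_notempty)
    then obtain w where "w \<in> D" "dist u w < d + 1 / real (Suc n)"
      using cInf_lessD[of "dist u ` D"] \<open>D \<noteq> {}\<close> by auto
    then have "w \<in> S n" by (simp add: S_def)
    then show ?thesis by blast
  qed
  have lim: "(\<lambda>n. 4 * ((d + 1 / real (Suc n))\<^sup>2 - d\<^sup>2)) \<longlonglongrightarrow> 4 * ((d + 0)\<^sup>2 - d\<^sup>2)"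
    by (intro tendsto_intros LIMSEQ_Suc lim_1_over_n)
  have diam: "\<exists>n. \<forall>x\<in>S n. \<forall>y\<in>S n. dist x y < e" if "e > 0" for e
  proof -
    have "\<forall>\<^sub>F n in sequentially. 4 * ((d + 1 / real (Suc n))\<^sup>2 - d\<^sup>2) < e\<^sup>2"
      using lim that by (intro order_tendstoD(2)) auto
    then obtain n where n: "4 * ((d + 1 / real (Suc n))\<^sup>2 - d\<^sup>2) < e\<^sup>2"
      using eventually_happens'[OF sequentially_bot] by blast
    have "dist x y < e" if "x \<in> S n" "y \<in> S n" for x y
    proof -
      have "(norm (x - y))\<^sup>2 < e\<^sup>2"
        using nearest_points_close[OF \<open>convex D\<close>, of x y d u "d + 1 / real (Suc n)"]
          that low d0 n by (auto simp: S_def dist_norm)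
      then show ?thesis
        using \<open>e > 0\<close> by (simp add: dist_norm power2_less_imp_less)
    qed
    then show ?thesis by blast
  qed
  have nest: "S n \<subseteq> S m" if "m \<le> n" for m n
  proof -
    have "1 / real (Suc n) \<le> 1 / real (Suc m)"
      using that by (intro divide_left_mono) auto
    then show ?thesis by (auto simp: S_def)
  qed
  obtain z where z: "\<And>n. z \<in> S n"
    using decreasing_closed_nest[of S] ne nest diam \<open>closed D\<close>
    by (auto simp: S_def)
  have "norm (u - z) \<le> d"
  proof (rule LIMSEQ_le_const)
    show "(\<lambda>n. d + 1 / real (Suc n)) \<longlonglongrightarrow> d"
      using tendsto_add[OF tendsto_const LIMSEQ_Suc[OF lim_1_over_n]] by simp
    show "\<exists>N. \<forall>n\<ge>N. norm (u - z) \<le> d + 1 / real (Suc n)"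
      using z by (auto simp: S_def dist_norm)
  qed
  moreover have "z \<in> D"
    using z by (auto simp: S_def)
  ultimately have z': "z \<in> D \<and> (\<forall>w\<in>D. norm (u - z) \<le> norm (u - w))"
    using low by force
  show ?thesis
  proof (rule ex1I[of _ z])
    fix y assume y: "y \<in> D \<and> (\<forall>w\<in>D. norm (u - y) \<le> norm (u - w))"
    have "(norm (y - z))\<^sup>2 \<le> 4 * ((norm (u - z))\<^sup>2 - (norm (u - z))\<^sup>2)"
      using y z' by (intro nearest_points_close[OF \<open>convex D\<close>, where u = u]) auto
    then show "y = z" by simp
  qed (fact z')
qed

lemma metric_proj_nearest:
  fixes u :: "'a::{real_inner,complete_space}"
  assumes "closed D" "convex D" "D \<noteq> {}"
  shows "metric_proj D u \<in> D" "\<And>w. w \<in> D \<Longrightarrow> norm (u - metric_proj D u) \<le> norm (u - w)"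
  using theI'[OF ex1_nearest_point[OF assms, of u]] unfolding metric_proj_def by auto

end

theory Submission
  imports Defs
begin

text \<open>Write \<open>u = x 0\<close>, \<open>F\<close> for the fixed point set and \<open>q\<close> for the projection
  of \<open>u\<close> onto \<open>F\<close>. The half-spaces \<open>Q n\<close> are built so that the angle at \<open>x n\<close> between
  \<open>u\<close> and any point \<open>z\<close> of \<open>Q n\<close> is obtuse, whence
  \<open>\<parallel>z - x n\<parallel>\<^sup>2 \<le> \<parallel>z - u\<parallel>\<^sup>2 - \<parallel>x n - u\<parallel>\<^sup>2\<close> (lemma
  \<open>obtuse_angle_pythagoras\<close>). By induction, with the variational inequality for projections,
  \<open>F\<close> stays inside every \<open>Q n\<close>. Taking \<open>z = x (n + 1)\<close> and \<open>z \<in> F\<close> shows that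
  \<open>\<parallel>x n - u\<parallel>\<close> increases to a limit \<open>l\<close> and that \<open>x (n + 1) - x n\<close> tends to \<open>0\<close>;
  Since \<open>\<alpha> n\<close> tends to \<open>0\<close>, so does \<open>v n - x n\<close>. Membership of \<open>x (n + 1)\<close> in \<open>Cn n\<close>
  then brings \<open>y n\<close> close to \<open>x n\<close>, and because \<open>y n - x n = \<beta> n (T (v n) - x n)\<close> with
  \<open>\<beta> n\<close> bounded away from \<open>0\<close>, also \<open>x n - T (x n)\<close> tends to \<open>0\<close>.
  Taking \<open>z = q\<close> bounds \<open>\<parallel>q - x n\<parallel>\<^sup>2\<close> by a quantity with limit
  \<open>\<parallel>q - u\<parallel>\<^sup>2 - l\<^sup>2\<close>, so it only remains to see that \<open>\<parallel>q - u\<parallel> \<le> l\<close>: approximate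
  fixed points cannot stay closer to \<open>u\<close> than \<open>F\<close> does.

  The usual argument for this last point takes a weak cluster point of \<open>x\<close> and applies
  demiclosedness of \<open>I - T\<close>. Here weak convergence is replaced by the resolvents of the
  monotone operator \<open>I - T\<close>, the solutions \<open>z\<close> of \<open>z - T z = \<theta> (u - z)\<close>. Monotonicity
  compares such a \<open>z\<close> with the approximate fixed points and gives \<open>\<parallel>z - u\<parallel> \<le> l\<close>
  (lemma \<open>approximate_fixed_points_distance\<close>). By Browder's theorem
  (lemma \<open>resolvents_converge\<close>) the resolvents converge strongly to \<open>q\<close> as \<open>\<theta>\<close> tends to
  \<open>0\<close>, because monotonicity also yields the obtuse angle inequality between any two of them.\<close>

section \<open>Hilbert space geometry\<close>

text \<open>The obtuse angle turns a comparison of distances to \<open>u\<close> into closeness of \<open>z\<close> and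
  \<open>w\<close>, which is how strong convergence is obtained throughout.\<close>

lemma obtuse_angle_pythagoras:
  fixes u w z :: "'a::real_inner"
  assumes "(z - w) \<bullet> (w - u) \<ge> 0"
  shows "(norm (z - w))\<^sup>2 \<le> (norm (z - u))\<^sup>2 - (norm (w - u))\<^sup>2"
proof -
  have "(norm (z - u))\<^sup>2 = (norm (z - w))\<^sup>2 + (norm (w - u))\<^sup>2 + 2 * ((z - w) \<bullet> (w - u))"
    unfolding power2_norm_eq_inner by (simp add: inner_simps inner_commute)
  then show ?thesis
    using assms by simp
qed

lemma metric_proj_variational:
  fixes u :: "'a::{real_inner,complete_space}"
  assumes "closed D" "convex D" "w \<in> D"
  shows "(w - metric_proj D u) \<bullet> (metric_proj D u - u) \<ge> 0"
proof -
  have ne: "D \<noteq> {}"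
    using assms(3) by blast
  have "(u - metric_proj D u) \<bullet> (w - metric_proj D u) \<le> 0"
    using metric_proj_nearest[OF assms(1,2) ne, where u = u] assms
    by (intro any_closest_point_dot[of D]) (auto simp: dist_norm)
  then show ?thesis
    by (simp add: inner_simps inner_commute)
qed

text \<open>The angle condition makes \<open>q\<close> the unique nearest point by itself, so the lemma applies
  to the fixed point set without first proving that this set is closed and convex.\<close>

lemma metric_proj_eqI:
  fixes u :: "'a::real_inner"
  assumes "q \<in> D" and ang: "\<And>w. w \<in> D \<Longrightarrow> (w - q) \<bullet> (q - u) \<ge> 0"
  shows "metric_proj D u = q"
  unfolding metric_proj_def
proof (rule the_equality)
  have "norm (u - q) \<le> norm (u - w)" if "w \<in> D" for w
  proof (rule power2_le_imp_le)
    show "(norm (u - q))\<^sup>2 \<le> (norm (u - w))\<^sup>2"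
      using obtuse_angle_pythagoras[OF ang[OF that]] zero_le_power2[of "norm (w - q)"]
      unfolding norm_minus_commute[of u] by linarith
  qed simp
  then show "q \<in> D \<and> (\<forall>w\<in>D. norm (u - q) \<le> norm (u - w))"
    using \<open>q \<in> D\<close> by blast
next
  fix z assume z: "z \<in> D \<and> (\<forall>w\<in>D. norm (u - z) \<le> norm (u - w))"
  then have "(norm (u - z))\<^sup>2 \<le> (norm (u - q))\<^sup>2"
    using \<open>q \<in> D\<close> by (intro power_mono) auto
  moreover have "(norm (z - q))\<^sup>2 \<le> (norm (z - u))\<^sup>2 - (norm (q - u))\<^sup>2"
    using z by (intro obtuse_angle_pythagoras ang) blast
  ultimately have "(norm (z - q))\<^sup>2 \<le> 0"
    unfolding norm_minus_commute[of u] by linarith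
  then show "z = q" by simp
qed

section \<open>Resolvents of a nonexpansive map\<close>

lemma displacement_monotone:
  fixes T :: "'a::real_inner \<Rightarrow> 'a"
  assumes "norm (T z - T w) \<le> norm (z - w)"
  shows "((z - T z) - (w - T w)) \<bullet> (z - w) \<ge> 0"
proof -
  have "(T z - T w) \<bullet> (z - w) \<le> norm (T z - T w) * norm (z - w)"
    by (rule norm_cauchy_schwarz)
  also have "\<dots> \<le> norm (z - w) * norm (z - w)"
    using assms by (intro mult_right_mono) auto
  also have "\<dots> = (z - w) \<bullet> (z - w)"
    by (simp add: power2_norm_eq_inner[symmetric] power2_eq_square)
  finally show ?thesis
    by (simp add: inner_simps inner_commute)
qed

text \<open>The equation says that \<open>z\<close> is fixed by the map sending \<open>z\<close> to the convex
  combination \<open>(\<theta> u + T z) / (1 + \<theta>)\<close>, a contraction of \<open>C\<close> with constant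
  \<open>1 / (1 + \<theta>)\<close>.\<close>

lemma resolvent_exists:
  fixes C :: "'a::{real_inner,complete_space} set"
  assumes "closed C" "convex C" "u \<in> C" "\<theta> > 0"
    and self: "\<And>u. u \<in> C \<Longrightarrow> T u \<in> C"
    and nonexp: "\<And>u w. u \<in> C \<Longrightarrow> w \<in> C \<Longrightarrow> norm (T u - T w) \<le> norm (u - w)"
  obtains z where "z \<in> C" "z - T z = \<theta> *\<^sub>R (u - z)"
proof -
  define c where "c = 1 / (1 + \<theta>)"
  have c: "0 \<le> c" "c < 1"
    using \<open>\<theta> > 0\<close> by (auto simp: c_def)
  define f where "f z = (1 - c) *\<^sub>R u + c *\<^sub>R T z" for z
  have "\<exists>!z\<in>C. f z = z"
  proof (rule Banach_fix[where c = c])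
    show "complete C"
      using \<open>closed C\<close> by (simp add: complete_eq_closed)
    show "f ` C \<subseteq> C"
      unfolding f_def using c by (intro image_subsetI convexD[OF \<open>convex C\<close>] \<open>u \<in> C\<close> self) simp_all
    show "dist (f z) (f w) \<le> c * dist z w" if "z \<in> C" "w \<in> C" for z w
    proof -
      have "f z - f w = c *\<^sub>R (T z - T w)"
        by (simp add: f_def algebra_simps)
      then show ?thesis
        using nonexp[OF that] c by (simp add: dist_norm mult_left_mono)
    qed
  qed (use c \<open>u \<in> C\<close> in auto)
  then obtain z where z: "z \<in> C" "f z = z" by blast
  have l: "(1 + \<theta>) * c = 1" "(1 + \<theta>) * (1 - c) = \<theta>"
    using \<open>\<theta> > 0\<close> by (auto simp: c_def field_simps)
  have "(1 + \<theta>) *\<^sub>R z = (1 + \<theta>) *\<^sub>R f z"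
    using z by simp
  also have "\<dots> = \<theta> *\<^sub>R u + T z"
    unfolding f_def scaleR_add_right scaleR_scaleR l by simp
  finally have "z - T z = \<theta> *\<^sub>R (u - z)"
    by (simp add: algebra_simps)
  with z show ?thesis using that by blast
qed

text \<open>Monotonicity of \<open>I - T\<close> orders the resolvents: the smaller parameter lies farther
  from \<open>u\<close>, in an obtuse position. A fixed point is a resolvent with parameter \<open>\<mu> = 0\<close>,
  so the same lemma compares resolvents with each other and with fixed points.\<close>

lemma resolvent_angle:
  fixes T :: "'a::real_inner \<Rightarrow> 'a"
  assumes nonexp: "norm (T z - T w) \<le> norm (z - w)"
    and z: "z - T z = \<theta> *\<^sub>R (u - z)" and w: "w - T w = \<mu> *\<^sub>R (u - w)"
    and "0 \<le> \<mu>" "\<mu> < \<theta>"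
  shows "(w - z) \<bullet> (z - u) \<ge> 0"
proof -
  have "0 \<le> (\<theta> *\<^sub>R (u - z) - \<mu> *\<^sub>R (u - w)) \<bullet> (z - w)"
    using displacement_monotone[of T z w, OF nonexp] unfolding z w .
  also have "\<dots> = (\<theta> - \<mu>) * ((w - z) \<bullet> (z - u)) - \<mu> * (norm (w - z))\<^sup>2"
    unfolding power2_norm_eq_inner by (simp add: inner_simps inner_commute algebra_simps)
  finally have "0 \<le> (\<theta> - \<mu>) * ((w - z) \<bullet> (z - u)) - \<mu> * (norm (w - z))\<^sup>2" .
  moreover have "0 \<le> \<mu> * (norm (w - z))\<^sup>2"
    using \<open>0 \<le> \<mu>\<close> by simp
  ultimately have "0 \<le> (\<theta> - \<mu>) * ((w - z) \<bullet> (z - u))" by linarith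
  then show ?thesis
    using \<open>\<mu> < \<theta>\<close> by (simp add: zero_le_mult_iff)
qed

text \<open>Browder's convergence theorem. By \<open>resolvent_angle\<close> the squared distances to \<open>u\<close>
  increase along the sequence, are bounded by that of any fixed point, and control the mutual
  distances of the resolvents, so these form a Cauchy sequence. The final inequality
  identifies the limit as the projection of \<open>u\<close> onto the fixed point set.\<close>

lemma resolvents_converge:
  fixes C :: "'a::{real_inner,complete_space} set"
  assumes C: "closed C" "convex C" "u \<in> C"
    and self: "\<And>u. u \<in> C \<Longrightarrow> T u \<in> C"
    and nonexp: "\<And>u w. u \<in> C \<Longrightarrow> w \<in> C \<Longrightarrow> norm (T u - T w) \<le> norm (u - w)"
    and "fix_set C T \<noteq> {}"
  obtains z q and \<theta> :: "nat \<Rightarrow> real"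
  where "\<And>k. z k \<in> C" "\<And>k. \<theta> k > 0" "\<And>k. z k - T (z k) = \<theta> k *\<^sub>R (u - z k)"
    and "z \<longlonglongrightarrow> q" "q \<in> fix_set C T"
    and "\<And>p. p \<in> fix_set C T \<Longrightarrow> (p - q) \<bullet> (q - u) \<ge> 0"
proof -
  define \<theta> :: "nat \<Rightarrow> real" where "\<theta> k = 1 / real (Suc k)" for k
  have pos: "\<theta> k > 0" for k by (simp add: \<theta>_def)
  have less: "\<theta> j < \<theta> i" if "i < j" for i j
    using that by (simp add: \<theta>_def divide_strict_left_mono)
  have lim0: "\<theta> \<longlonglongrightarrow> 0"
    unfolding \<theta>_def by (intro LIMSEQ_Suc lim_1_over_n)
  have "\<exists>z. z \<in> C \<and> z - T z = \<theta> k *\<^sub>R (u - z)" for k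
    using resolvent_exists[OF C pos self nonexp] by blast
  then obtain z where zC: "\<And>k. z k \<in> C" and z: "\<And>k. z k - T (z k) = \<theta> k *\<^sub>R (u - z k)"
    by metis
  \<comment> \<open>A fixed point solves the resolvent equation with parameter \<open>0\<close>.\<close>
  have fixed: "(p - z k) \<bullet> (z k - u) \<ge> 0" if "p \<in> fix_set C T" for p k
    using that pos[of k] zC
    by (intro resolvent_angle[of T "z k" p "\<theta> k" u 0] nonexp z) (auto simp: fix_set_def)
  define r where "r k = (norm (z k - u))\<^sup>2" for k
  have step: "(norm (z j - z i))\<^sup>2 \<le> r j - r i" if "i \<le> j" for i j
  proof (cases "i = j")
    case False
    then have "i < j" using that by simp
    then show ?thesis
      unfolding r_def using pos[of j]
      by (intro obtuse_angle_pythagoras resolvent_angle[of T _ _ "\<theta> i" u "\<theta> j"] nonexp zC z less)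
         auto
  qed simp
  obtain p where p: "p \<in> fix_set C T" using \<open>fix_set C T \<noteq> {}\<close> by blast
  have bd: "r k \<le> (norm (p - u))\<^sup>2" for k
    using obtuse_angle_pythagoras[OF fixed[OF p, of k]] zero_le_power2[of "norm (p - z k)"]
    unfolding r_def by linarith
  have "incseq r"
  proof (rule incseq_SucI)
    show "r k \<le> r (Suc k)" for k
      using step[of k "Suc k"] zero_le_power2[of "norm (z (Suc k) - z k)"] by linarith
  qed
  then obtain l where l: "r \<longlonglongrightarrow> l"
    using incseq_convergent[of r "(norm (p - u))\<^sup>2"] bd by blast
  have "Cauchy z"
  proof (rule metric_CauchyI)
    fix e :: real assume "e > 0"
    have "Cauchy r" using l by (rule LIMSEQ_imp_Cauchy)
    then obtain N where N: "\<And>i j. i \<ge> N \<Longrightarrow> j \<ge> N \<Longrightarrow> dist (r i) (r j) < e\<^sup>2"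
      using \<open>e > 0\<close> by (metis metric_CauchyD zero_less_power)
    have ordered: "dist (z j) (z i) < e" if "i \<ge> N" "i \<le> j" for i j
    proof -
      have "(norm (z j - z i))\<^sup>2 < e\<^sup>2"
        using step[OF that(2)] N[of j i] that by (simp add: dist_real_def)
      then show ?thesis
        using \<open>e > 0\<close> by (simp add: dist_norm power2_less_imp_less)
    qed
    have "dist (z i) (z j) < e" if "i \<ge> N" "j \<ge> N" for i j
      using ordered[of i j] ordered[of j i] that by (cases "i \<le> j") (auto simp: dist_commute)
    then show "\<exists>N. \<forall>i\<ge>N. \<forall>j\<ge>N. dist (z i) (z j) < e" by blast
  qed
  then obtain q where q: "z \<longlonglongrightarrow> q"
    using convergent_eq_Cauchy by blast
  have qC: "q \<in> C"
    using \<open>closed C\<close> zC q by (rule closed_sequentially)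
  have "(\<lambda>k. T (z k)) \<longlonglongrightarrow> T q"
  proof (rule metric_LIMSEQ_I)
    fix e :: real assume "e > 0"
    then obtain N where "\<forall>k\<ge>N. dist (z k) q < e"
      using q by (metis metric_LIMSEQ_D)
    then show "\<exists>N. \<forall>k\<ge>N. dist (T (z k)) (T q) < e"
      using nonexp[OF zC qC] unfolding dist_norm by (meson le_less_trans)
  qed
  moreover have "(\<lambda>k. z k - \<theta> k *\<^sub>R (u - z k)) \<longlonglongrightarrow> q - 0 *\<^sub>R (u - q)"
    by (intro tendsto_intros q lim0)
  moreover have "z k - \<theta> k *\<^sub>R (u - z k) = T (z k)" for k
    using z[of k] by (simp add: algebra_simps)
  ultimately have "T q = q"
    using LIMSEQ_unique by auto
  with qC have qF: "q \<in> fix_set C T" by (simp add: fix_set_def)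
  have "(p' - q) \<bullet> (q - u) \<ge> 0" if "p' \<in> fix_set C T" for p'
  proof (rule LIMSEQ_le_const)
    show "(\<lambda>k. (p' - z k) \<bullet> (z k - u)) \<longlonglongrightarrow> (p' - q) \<bullet> (q - u)"
      by (intro tendsto_intros q)
    show "\<exists>N. \<forall>k\<ge>N. 0 \<le> (p' - z k) \<bullet> (z k - u)"
      using fixed[OF that] by blast
  qed
  with zC pos z q qF show ?thesis by (rule that)
qed

section \<open>Approximate fixed points\<close>

text \<open>For a resolvent \<open>z\<close> of \<open>u\<close> with parameter \<open>\<theta>\<close>, monotonicity bounds
  \<open>\<theta> (u - z) \<bullet> (z - w n)\<close> from below by \<open>(w n - T (w n)) \<bullet> (z - w n)\<close>, which tends
  to \<open>0\<close>. In the limit \<open>\<parallel>z - u\<parallel> (l - \<parallel>z - u\<parallel>) \<ge> 0\<close>, so \<open>\<parallel>z - u\<parallel> \<le> l\<close>, and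
  this bound passes to the strong limit of the resolvents.\<close>

lemma approximate_fixed_points_distance:
  fixes C :: "'a::{real_inner,complete_space} set"
  assumes C: "closed C" "convex C" "u \<in> C"
    and self: "\<And>u. u \<in> C \<Longrightarrow> T u \<in> C"
    and nonexp: "\<And>u w. u \<in> C \<Longrightarrow> w \<in> C \<Longrightarrow> norm (T u - T w) \<le> norm (u - w)"
    and "fix_set C T \<noteq> {}"
    and w: "\<And>n. w n \<in> C" "(\<lambda>n. w n - T (w n)) \<longlonglongrightarrow> 0"
    and l: "(\<lambda>n. norm (w n - u)) \<longlonglongrightarrow> l"
  shows "metric_proj (fix_set C T) u \<in> fix_set C T" (is "?P \<in> _")
    and "norm (metric_proj (fix_set C T) u - u) \<le> l"
proof -
  obtain z q and \<theta> :: "nat \<Rightarrow> real"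
    where zC: "\<And>k. z k \<in> C" and pos: "\<And>k. \<theta> k > 0"
      and z: "\<And>k. z k - T (z k) = \<theta> k *\<^sub>R (u - z k)"
      and q: "z \<longlonglongrightarrow> q" "q \<in> fix_set C T"
      and ang: "\<And>p. p \<in> fix_set C T \<Longrightarrow> (p - q) \<bullet> (q - u) \<ge> 0"
    using resolvents_converge[OF C self nonexp \<open>fix_set C T \<noteq> {}\<close>] by (metis (no_types))
  have P: "?P = q"
    using q(2) ang by (rule metric_proj_eqI)
  show "?P \<in> fix_set C T" using P q by simp
  have "l \<ge> 0"
    using l by (rule LIMSEQ_le_const) auto
  have "norm (z k - u) \<le> l" for k
  proof -
    define d where "d = norm (z k - u)"
    have "Bseq (\<lambda>n. norm (w n - u))"
      using l by (intro convergent_imp_Bseq convergentI)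
    then obtain B where B: "\<And>n. norm (w n - u) \<le> B"
      by (auto simp: Bseq_def)
    have bd: "norm (z k - w n) \<le> d + B" for n
      using norm_triangle_ineq4[of "z k - u" "w n - u"] B[of n] by (simp add: d_def)
    have lower: "- (norm (w n - T (w n)) * (d + B)) \<le> \<theta> k * (d * (norm (w n - u) - d))" for n
    proof -
      have "- (norm (w n - T (w n)) * (d + B)) \<le> - (norm (w n - T (w n)) * norm (z k - w n))"
        using bd[of n] by (simp add: mult_left_mono)
      also have "\<dots> \<le> (w n - T (w n)) \<bullet> (z k - w n)"
        using Cauchy_Schwarz_ineq2[of "w n - T (w n)" "z k - w n"] by linarith
      also have "\<dots> \<le> (z k - T (z k)) \<bullet> (z k - w n)"
        using displacement_monotone[of T "z k" "w n", OF nonexp[OF zC w(1)]]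
        by (simp add: inner_diff_left)
      also have "\<dots> = \<theta> k * ((z k - u) \<bullet> (w n - u) - d\<^sup>2)"
        unfolding z d_def power2_norm_eq_inner by (simp add: inner_simps inner_commute algebra_simps)
      also have "\<dots> \<le> \<theta> k * (d * norm (w n - u) - d\<^sup>2)"
        using norm_cauchy_schwarz[of "z k - u" "w n - u"] pos[of k]
        by (intro mult_left_mono) (auto simp: d_def)
      finally show ?thesis
        by (simp add: power2_eq_square algebra_simps)
    qed
    have "- (0 * (d + B)) \<le> \<theta> k * (d * (l - d))"
    proof (rule LIMSEQ_le)
      show "(\<lambda>n. - (norm (w n - T (w n)) * (d + B))) \<longlonglongrightarrow> - (0 * (d + B))"
        using w(2) by (intro tendsto_intros) (rule tendsto_norm_zero)
      show "(\<lambda>n. \<theta> k * (d * (norm (w n - u) - d))) \<longlonglongrightarrow> \<theta> k * (d * (l - d))"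
        by (intro tendsto_intros l)
    qed (use lower in blast)
    then have "0 \<le> d * (l - d)"
      using pos[of k] by (simp add: zero_le_mult_iff)
    then show ?thesis
      using \<open>l \<ge> 0\<close> by (auto simp: d_def zero_le_mult_iff)
  qed
  moreover have "(\<lambda>k. norm (z k - u)) \<longlonglongrightarrow> norm (q - u)"
    by (intro tendsto_intros q)
  ultimately show "norm (?P - u) \<le> l"
    unfolding P by (intro LIMSEQ_le_const2[of _ "norm (q - u)"]) auto
qed

section \<open>The hybrid iteration\<close>

theorem theorem6p6:
  fixes C :: "'a::{real_inner,complete_space} set"
    and T :: "'a \<Rightarrow> 'a"
    and \<alpha> \<beta> :: "nat \<Rightarrow> real"
    and b :: real
    and x v y :: "nat \<Rightarrow> 'a"
    and Cn Cstar Q :: "nat \<Rightarrow> 'a set"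
  assumes "C \<noteq> {}" and "closed C" and "convex C"
    and "\<And>u. u \<in> C \<Longrightarrow> T u \<in> C"
    and "\<And>u w. u \<in> C \<Longrightarrow> w \<in> C \<Longrightarrow> norm (T u - T w) \<le> norm (u - w)"
    and "fix_set C T \<noteq> {}"
    and "\<And>n. 0 \<le> \<alpha> n \<and> \<alpha> n \<le> 1"
    and "0 < b" and "\<And>n. b \<le> \<beta> n \<and> \<beta> n \<le> 1"
    and "\<alpha> \<longlonglongrightarrow> 0"
    and "x 0 \<in> C"
    and "\<And>n. v n = (1 - \<alpha> n) *\<^sub>R x n + \<alpha> n *\<^sub>R T (x n)"
    and "\<And>n. y n = (1 - \<beta> n) *\<^sub>R x n + \<beta> n *\<^sub>R T (v n)"
    and "\<And>n. Cn n = {z \<in> C. (norm (z - y n))\<^sup>2 \<le> (norm (z - x n))\<^sup>2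
            + \<beta> n * ((norm (v n))\<^sup>2 - (norm (x n))\<^sup>2 + 2 * ((x n - v n) \<bullet> z))}"
    and "\<And>n. Q n = {z \<in> C. (z - x n) \<bullet> (x n - x 0) \<ge> 0}"
    and "\<And>n. closed (Cstar n) \<and> convex (Cstar n)"
    and "\<And>n. fix_set C T \<subseteq> Cstar n \<and> Cstar n \<subseteq> Cn n"
    and "\<And>n. x (Suc n) = metric_proj (Cstar n \<inter> Q n) (x 0)"
  shows "x \<longlonglongrightarrow> metric_proj (fix_set C T) (x 0)"
proof -
  note self = assms(4) and nonexp = assms(5)
  note v = assms(12) and y = assms(13) and Cn = assms(14) and Q = assms(15) and iter = assms(18)
  define D where "D n = Cstar n \<inter> Q n" for n
  have "Q n = C \<inter> {z. (x n - x 0) \<bullet> z \<ge> (x n - x 0) \<bullet> x n}" for n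
    by (auto simp: Q inner_diff_left inner_commute)
  then have D: "closed (D n)" "convex (D n)" for n
    using assms(2,3,16)
    by (auto simp: D_def intro!: closed_Int convex_Int closed_halfspace_ge convex_halfspace_ge)
  \<comment> \<open>This invariant keeps \<open>D n\<close> nonempty, so that the projections exist, and gives the obtuse
    angle between \<open>x 0\<close> and every fixed point at \<open>x n\<close>.\<close>
  have FD: "fix_set C T \<subseteq> D n" for n
  proof (induction n)
    case 0
    show ?case
      using assms(17)[of 0] by (auto simp: D_def Q fix_set_def)
  next
    case (Suc n)
    have "(p - x (Suc n)) \<bullet> (x (Suc n) - x 0) \<ge> 0" if "p \<in> fix_set C T" for p
      unfolding iter D_def[symmetric] using D Suc that by (intro metric_proj_variational) auto
    then show ?case
      using assms(17)[of "Suc n"] by (auto simp: D_def Q fix_set_def)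
  qed
  have nextD: "x (Suc n) \<in> D n" for n
    unfolding iter D_def[symmetric] using D FD assms(6)
    by (intro metric_proj_nearest) blast+
  have xC: "x n \<in> C" for n
    using nextD[of "n - 1"] assms(11) by (cases n) (auto simp: D_def Q)
  have vC: "v n \<in> C" for n
    unfolding v using assms(7)[of n] by (intro convexD[OF assms(3)] xC self) simp_all
  obtain p where p: "p \<in> fix_set C T" using assms(6) by blast
  have pC: "p \<in> C" "T p = p"
    using p by (auto simp: fix_set_def)

  define r where "r n = (norm (x n - x 0))\<^sup>2" for n
  have below: "(norm (p' - x n))\<^sup>2 \<le> (norm (p' - x 0))\<^sup>2 - r n" if "p' \<in> fix_set C T" for p' n
    unfolding r_def using FD[of n] that
    by (intro obtuse_angle_pythagoras) (auto simp: D_def Q)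
  have step: "(norm (x (Suc n) - x n))\<^sup>2 \<le> r (Suc n) - r n" for n
    unfolding r_def using nextD[of n]
    by (intro obtuse_angle_pythagoras) (auto simp: D_def Q)
  have rbd: "r n \<le> (norm (p - x 0))\<^sup>2" for n
    using below[OF p, of n] zero_le_power2[of "norm (p - x n)"] by linarith
  have "incseq r"
  proof (rule incseq_SucI)
    show "r n \<le> r (Suc n)" for n
      using step[of n] zero_le_power2[of "norm (x (Suc n) - x n)"] by linarith
  qed
  then obtain L where L: "r \<longlonglongrightarrow> L"
    using incseq_convergent[of r "(norm (p - x 0))\<^sup>2"] rbd by blast
  have "(\<lambda>n. r (Suc n) - r n) \<longlonglongrightarrow> 0"
    using tendsto_diff[OF LIMSEQ_Suc[OF L] L] by simp
  then have "(\<lambda>n. (norm (x (Suc n) - x n))\<^sup>2) \<longlonglongrightarrow> 0"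
    by (rule Lim_null_comparison[OF always_eventually, rotated]) (use step in auto)
  then have move: "(\<lambda>n. norm (x (Suc n) - x n)) \<longlonglongrightarrow> 0"
    by (simp add: power_tendsto_0_iff)

  have px: "norm (p - x n) \<le> norm (p - x 0)" for n
  proof (rule power2_le_imp_le)
    show "(norm (p - x n))\<^sup>2 \<le> (norm (p - x 0))\<^sup>2"
      using below[OF p, of n] zero_le_power2[of "norm (x n - x 0)"] unfolding r_def by linarith
  qed simp
  have vx: "norm (v n - x n) \<le> \<alpha> n * (2 * norm (p - x 0))" for n
  proof -
    have "v n - x n = \<alpha> n *\<^sub>R ((T (x n) - T p) + (p - x n))"
      by (simp add: v pC algebra_simps)
    then have "norm (v n - x n) = \<alpha> n * norm ((T (x n) - T p) + (p - x n))"
      using assms(7)[of n] by simp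
    also have "\<dots> \<le> \<alpha> n * (2 * norm (p - x 0))"
      using norm_triangle_ineq[of "T (x n) - T p" "p - x n"] nonexp[OF xC[of n] pC(1)] px[of n]
        assms(7)[of n]
      by (intro mult_left_mono) (auto simp: norm_minus_commute)
    finally show ?thesis .
  qed
  have "(\<lambda>n. \<alpha> n * (2 * norm (p - x 0))) \<longlonglongrightarrow> 0"
    using assms(10) by (rule tendsto_mult_left_zero)
  then have "(\<lambda>n. v n - x n) \<longlonglongrightarrow> 0"
    by (rule Lim_null_comparison[OF always_eventually, rotated]) (use vx in auto)
  then have vx0: "(\<lambda>n. norm (v n - x n)) \<longlonglongrightarrow> 0"
    by (rule tendsto_norm_zero)

  have yx: "norm (y n - x n) \<le> 2 * norm (x (Suc n) - x n) + norm (v n - x n)" for n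
  proof -
    let ?m = "norm (x (Suc n) - x n)" and ?e = "norm (v n - x n)"
    \<comment> \<open>The inequality defining \<open>Cn n\<close> bounds the squared distance to \<open>y n\<close> by a convex combination
      of those to \<open>x n\<close> and \<open>v n\<close>.\<close>
    have id: "(norm (v n))\<^sup>2 - (norm (x n))\<^sup>2 + 2 * ((x n - v n) \<bullet> z)
        = (norm (z - v n))\<^sup>2 - (norm (z - x n))\<^sup>2" for z
      unfolding power2_norm_eq_inner by (simp add: inner_simps inner_commute algebra_simps)
    have "x (Suc n) \<in> Cn n"
      using nextD[of n] assms(17)[of n] by (auto simp: D_def)
    then have "(norm (x (Suc n) - y n))\<^sup>2
        \<le> ?m\<^sup>2 + \<beta> n * ((norm (x (Suc n) - v n))\<^sup>2 - ?m\<^sup>2)"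
      unfolding Cn id by simp
    also have "\<dots> = (1 - \<beta> n) * ?m\<^sup>2 + \<beta> n * (norm (x (Suc n) - v n))\<^sup>2"
      by (simp add: algebra_simps)
    also have "\<dots> \<le> (1 - \<beta> n) * (?m + ?e)\<^sup>2 + \<beta> n * (?m + ?e)\<^sup>2"
      using assms(9)[of n] \<open>0 < b\<close> norm_triangle_ineq4[of "x (Suc n) - x n" "v n - x n"]
      by (intro add_mono mult_left_mono power_mono) auto
    finally have "(norm (x (Suc n) - y n))\<^sup>2 \<le> (?m + ?e)\<^sup>2"
      by (simp add: algebra_simps)
    then have "norm (x (Suc n) - y n) \<le> ?m + ?e"
      by (rule power2_le_imp_le) simp
    then show ?thesis
      using norm_triangle_ineq4[of "x (Suc n) - x n" "x (Suc n) - y n"] by simp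
  qed
  have Tx: "norm (x n - T (x n))
      \<le> (2 * norm (x (Suc n) - x n) + norm (v n - x n)) / b + norm (v n - x n)" for n
  proof -
    have "y n - x n = \<beta> n *\<^sub>R (T (v n) - x n)"
      by (simp add: y algebra_simps)
    then have "norm (y n - x n) = \<beta> n * norm (T (v n) - x n)"
      using assms(9)[of n] \<open>0 < b\<close> by simp
    moreover have "b * norm (T (v n) - x n) \<le> \<beta> n * norm (T (v n) - x n)"
      using assms(9)[of n] by (intro mult_right_mono) auto
    ultimately have "b * norm (T (v n) - x n) \<le> 2 * norm (x (Suc n) - x n) + norm (v n - x n)"
      using yx[of n] by linarith
    then have "norm (T (v n) - x n) \<le> (2 * norm (x (Suc n) - x n) + norm (v n - x n)) / b"
      using \<open>0 < b\<close> by (simp add: field_simps)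
    then show ?thesis
      using nonexp[OF vC[of n] xC[of n]] norm_triangle_ineq4[of "T (v n) - T (x n)" "T (v n) - x n"]
      by simp
  qed
  have "(\<lambda>n. (2 * norm (x (Suc n) - x n) + norm (v n - x n)) / b + norm (v n - x n))
      \<longlonglongrightarrow> 0"
    using tendsto_add[OF tendsto_divide[OF tendsto_add[OF tendsto_mult[OF tendsto_const[of 2] move] vx0]
        tendsto_const[of b]] vx0] \<open>0 < b\<close>
    by simp
  then have Tx0: "(\<lambda>n. x n - T (x n)) \<longlonglongrightarrow> 0"
    by (rule Lim_null_comparison[OF always_eventually, rotated]) (use Tx in auto)

  have Lpos: "0 \<le> L"
    using L by (rule LIMSEQ_le_const) (auto simp: r_def)
  define q where "q = metric_proj (fix_set C T) (x 0)"
  have "(\<lambda>n. norm (x n - x 0)) \<longlonglongrightarrow> sqrt L"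
    using tendsto_real_sqrt[OF L] by (simp add: r_def)
  from approximate_fixed_points_distance[OF assms(2,3,11) self nonexp assms(6) xC Tx0 this]
  have qF: "q \<in> fix_set C T" and "norm (q - x 0) \<le> sqrt L"
    by (auto simp: q_def)
  then have "(norm (q - x 0))\<^sup>2 \<le> L"
    using Lpos power_mono[of "norm (q - x 0)" "sqrt L" 2] by simp
  then have qx: "(norm (q - x n))\<^sup>2 \<le> L - r n" for n
    using below[OF qF, of n] by linarith
  have "(\<lambda>n. L - r n) \<longlonglongrightarrow> 0"
    using tendsto_diff[OF tendsto_const L, of L] by simp
  then have "(\<lambda>n. (norm (q - x n))\<^sup>2) \<longlonglongrightarrow> 0"
    by (rule Lim_null_comparison[OF always_eventually, rotated]) (use qx in auto)
  then have "(\<lambda>n. norm (x n - q)) \<longlonglongrightarrow> 0"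
    by (simp add: power_tendsto_0_iff norm_minus_commute)
  then show ?thesis
    unfolding q_def[symmetric] by (simp add: tendsto_norm_zero_iff LIM_zero_iff)
qed

end
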